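(* Let $c>1$ be a constant and $p=cq$. Let $A$ be the adjacency matrix of a graph on $N$ vertices and define $$T_{\rm lin}=\sum_{i<j}A_{ij},\qquad T_{\rm scan}=\max_{S'\subset[N]:\,|S'|=K}\ \sum_{i,j\in S':\,i<j}A_{ij}.$$ Set $\tau_1=\binom N2 q+\binom K2\frac{p-q}{2}$ and $\tau_2=\binom K2\frac{p+q}{2}$. Then there exists a constant $C>0$ which only depends on $c$ such that $$\mathbb P_0[T_{\rm lin}>\tau_1]+\mathbb P_1[T_{\rm lin}\le\tau_1]\le 2\exp\left(-C\frac{K^4q}{N^2}\right)+\exp\left(-\frac K{200}\right),$$ $$\mathbb P_0[T_{\rm scan}>\tau_2]+\mathbb P_1[T_{\rm scan}\le\tau_2]\le 2\exp\left(K\log\frac{Ne}{K}-CK^2q\right)+\exp\left(-\frac K{200}\right),$$ where the graph is distributed as $\mathcal G(N,q)$ under $\mathbb P_0$ and as $\mathcal G(N,K,p,q)$ under $\mathbb P_1$.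
   Context: Here $N,K$ are integers with $1\le K\le N$ and $[N]=\{1,\dots,N\}$. $\mathcal G(N,q)$ is the Erdős–Rényi random graph on $N$ vertices, each pair of vertices being connected independently with probability $q$. $\mathcal G(N,K,p,q)$ (with $p>q$) is the planted dense subgraph model on $N$ vertices: each vertex is included in a random set $S$ independently with probability $K/N$; given $S$, each pair of vertices is connected independently, with probability $p$ if both vertices are in $S$ and with probability $q$ otherwise. $\log$ is the natural logarithm. *)

theory Defs
  imports "HOL-Probability.Probability"
begin

text \<open>A simple graph on the vertex set \<open>{1..N}\<close> is represented by its set of edges, each edge
  being a two-element set of vertices.\<close>

definition vertex_pairs :: "nat \<Rightarrow> nat set set" where
  "vertex_pairs N = {e. e \<subseteq> {1..N} \<and> card e = 2}"

definition adj :: "nat set set \<Rightarrow> nat \<Rightarrow> nat \<Rightarrow> real" where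
  "adj E i j = of_bool (i \<noteq> j \<and> {i, j} \<in> E)"

definition bernoulli_subset :: "'a set \<Rightarrow> ('a \<Rightarrow> real) \<Rightarrow> 'a set pmf" where
  "bernoulli_subset V w = map_pmf (\<lambda>X. {x. X x}) (Pi_pmf V False (\<lambda>x. bernoulli_pmf (w x)))"

definition erdos_renyi :: "nat \<Rightarrow> real \<Rightarrow> nat set set pmf" where
  "erdos_renyi N q = bernoulli_subset (vertex_pairs N) (\<lambda>_. q)"

definition planted_dense_subgraph :: "nat \<Rightarrow> nat \<Rightarrow> real \<Rightarrow> real \<Rightarrow> nat set set pmf" where
  "planted_dense_subgraph N K p q =
     bind_pmf (bernoulli_subset {1..N} (\<lambda>_. real K / real N))
       (\<lambda>S. bernoulli_subset (vertex_pairs N) (\<lambda>e. if e \<subseteq> S then p else q))"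

definition T_lin :: "nat \<Rightarrow> (nat \<Rightarrow> nat \<Rightarrow> real) \<Rightarrow> real" where
  "T_lin N A = (\<Sum>(i, j) \<in> {(i, j). i \<in> {1..N} \<and> j \<in> {1..N} \<and> i < j}. A i j)"

definition T_scan :: "nat \<Rightarrow> nat \<Rightarrow> (nat \<Rightarrow> nat \<Rightarrow> real) \<Rightarrow> real" where
  "T_scan N K A =
     Max ((\<lambda>S. \<Sum>(i, j) \<in> {(i, j). i \<in> S \<and> j \<in> S \<and> i < j}. A i j)
            ` {S. S \<subseteq> {1..N} \<and> card S = K})"

definition tau1 :: "nat \<Rightarrow> nat \<Rightarrow> real \<Rightarrow> real \<Rightarrow> real" where
  "tau1 N K p q = real (N choose 2) * q + real (K choose 2) * ((p - q) / 2)"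

definition tau2 :: "nat \<Rightarrow> real \<Rightarrow> real \<Rightarrow> real" where
  "tau2 K p q = real (K choose 2) * ((p + q) / 2)"

end

theory Submission
  imports Defs
begin

text \<open>
  Both statistics count the edges of the graph inside vertex sets \<open>V\<close>: the whole vertex set for the
  linear test, all \<open>K\<close>-subsets for the scan test. The exponential Markov inequality for sums of
  independent indicators bounds every tail. Under the null hypothesis the excess over the mean is
  \<open>(K choose 2) (p - q) / 2\<close>, and the scan test costs a union bound over
  \<open>N choose K \<le> (N e / K) ^ K\<close> sets. Under the alternative \<open>|S| \<ge> 9 K / 10\<close> up to
  probability \<open>exp (- K / 200)\<close>; since \<open>s choose 2 \<ge> 7/10 (K choose 2)\<close> for
  \<open>s \<ge> 9 K / 10\<close> and \<open>K \<ge> 2\<close>, the mean in a suitable \<open>V\<close> exceeds the threshold by at least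
  \<open>(K choose 2) (p - q) / 5\<close>. For \<open>K = 1\<close> the right-hand sides are at least \<open>2\<close>.
\<close>

section \<open>Both test statistics as edge counts inside vertex sets\<close>

definition pairs :: "'a set \<Rightarrow> 'a set set" where
  "pairs V = {e. e \<subseteq> V \<and> card e = 2}"

lemma vertex_pairs_eq: "vertex_pairs N = pairs {1..N}"
  by (simp add: vertex_pairs_def pairs_def)

lemma finite_pairs: "finite V \<Longrightarrow> finite (pairs V)"
  unfolding pairs_def by (rule finite_subset[of _ "Pow V"]) auto

lemma card_pairs: "finite V \<Longrightarrow> card (pairs V) = card V choose 2"
  unfolding pairs_def by (rule n_subsets)

lemma pairs_mono: "V \<subseteq> W \<Longrightarrow> pairs V \<subseteq> pairs W"
  by (auto simp: pairs_def)

text \<open>The statistics sum over ordered index pairs, whereas the random graph is a random set of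
  two-element edges. This translation turns each statistic into the size of a random set intersected
  with a fixed one, the form that the tail bounds treat.\<close>

lemma sum_adj_eq_card:
  assumes "finite V"
  shows "(\<Sum>(i, j)\<in>{(i, j). i \<in> V \<and> j \<in> V \<and> i < j}. adj G i j) = real (card (G \<inter> pairs V))"
proof -
  let ?P = "{(i, j). i \<in> V \<and> j \<in> V \<and> i < j}"
  have fin: "finite ?P"
    by (rule finite_subset[of _ "V \<times> V"]) (use assms in auto)
  have bij: "bij_betw (\<lambda>(i, j). {i, j}) ?P (pairs V)"
    unfolding bij_betw_def
  proof
    show "inj_on (\<lambda>(i, j). {i, j}) ?P"
      by (auto simp: inj_on_def doubleton_eq_iff)
    show "(\<lambda>(i, j). {i, j}) ` ?P = pairs V"
    proof (intro equalityI subsetI)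
      fix e assume "e \<in> pairs V"
      then obtain i j where "e = {i, j}" "i \<noteq> j" "i \<in> V" "j \<in> V"
        by (auto simp: pairs_def card_2_iff)
      \<comment> \<open>Sorting the two endpoints gives the preimage with smaller index
        first.\<close>
      then have "e = (\<lambda>(i, j). {i, j}) (min i j, max i j)" "(min i j, max i j) \<in> ?P"
        by (auto simp: min_def max_def)
      then show "e \<in> (\<lambda>(i, j). {i, j}) ` ?P" by blast
    qed (auto simp: pairs_def)
  qed
  have "(\<Sum>(i, j)\<in>?P. adj G i j) = (\<Sum>x\<in>?P. of_bool ((\<lambda>(i, j). {i, j}) x \<in> G))"
    by (intro sum.cong) (auto simp: adj_def)
  also have "\<dots> = (\<Sum>e\<in>pairs V. of_bool (e \<in> G))"
    by (rule sum.reindex_bij_betw[OF bij])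
  also have "\<dots> = real (card (pairs V \<inter> G))"
    using finite_pairs[OF assms] by (simp add: Int_def)
  finally show ?thesis by (simp add: Int_commute)
qed

lemma T_lin_eq_card: "T_lin N (adj G) = real (card (G \<inter> pairs {1..N}))"
  unfolding T_lin_def by (rule sum_adj_eq_card) simp

lemma T_scan_eq_Max:
  "T_scan N K (adj G) = Max ((\<lambda>V. real (card (G \<inter> pairs V))) ` {V. V \<subseteq> {1..N} \<and> card V = K})"
  unfolding T_scan_def
  by (intro arg_cong[where f = Max] image_cong refl sum_adj_eq_card) (auto intro: finite_subset)

lemma finite_subsets_of_card: "finite {V. V \<subseteq> {1..N::nat} \<and> card V = K}"
  by (rule finite_subset[of _ "Pow {1..N}"]) auto

lemma subsets_of_card_nonempty:
  assumes "K \<le> N"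
  shows "{V. V \<subseteq> {1..N::nat} \<and> card V = K} \<noteq> {}"
proof -
  have "{1..K} \<in> {V. V \<subseteq> {1..N} \<and> card V = K}" using assms by auto
  then show ?thesis by blast
qed

lemma T_scan_gt_iff:
  assumes "K \<le> N"
  shows "T_scan N K (adj G) > t \<longleftrightarrow>
    (\<exists>V. V \<subseteq> {1..N} \<and> card V = K \<and> real (card (G \<inter> pairs V)) > t)"
  unfolding T_scan_eq_Max
  by (subst Max_gr_iff)
    (use subsets_of_card_nonempty[OF assms] in \<open>auto simp: finite_subsets_of_card\<close>)

section \<open>Exponential tail bounds for the size of a random subset\<close>

lemma finite_set_bernoulli_subset:
  assumes "finite V"
  shows "finite (set_pmf (bernoulli_subset V w))"
proof -
  have "set_pmf (bernoulli_subset V w) \<subseteq> Pow V"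
    using set_Pi_pmf_subset[OF assms, of False] by (auto simp: bernoulli_subset_def)
  then show ?thesis using assms by (meson finite_Pow_iff finite_subset)
qed

text \<open>By independence the expectation factors over the elements, and
  \<open>1 + y \<le> exp y\<close> bounds each factor. The sign of \<open>l\<close> is free, so both
  tails can use the bound.\<close>

lemma bernoulli_subset_mgf_le:
  fixes l :: real
  assumes V: "finite V" and F: "F \<subseteq> V" and w: "\<And>x. x \<in> V \<Longrightarrow> 0 \<le> w x \<and> w x \<le> 1"
  shows "measure_pmf.expectation (bernoulli_subset V w) (\<lambda>G. exp (l * real (card (G \<inter> F))))
    \<le> exp ((exp l - 1) * (\<Sum>x\<in>F. w x))"
proof -
  have finF: "finite F" using V F by (rule rev_finite_subset)
  define f where "f x b = (if x \<in> F \<and> b then exp l else 1)" for x and b :: bool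
  have "exp (l * real (card ({x. X x} \<inter> F))) = (\<Prod>x\<in>V. f x (X x))" for X
  proof -
    have "(\<Prod>x\<in>V. f x (X x)) = (\<Prod>x\<in>{x. X x} \<inter> F. exp l)"
      using F by (intro prod.mono_neutral_cong_right V) (auto simp: f_def)
    then show ?thesis by (simp add: exp_of_nat2_mult)
  qed
  then have "measure_pmf.expectation (bernoulli_subset V w) (\<lambda>G. exp (l * real (card (G \<inter> F))))
      = measure_pmf.expectation (Pi_pmf V False (\<lambda>x. bernoulli_pmf (w x))) (\<lambda>X. \<Prod>x\<in>V. f x (X x))"
    by (simp add: bernoulli_subset_def)
  also have "\<dots> = (\<Prod>x\<in>V. measure_pmf.expectation (bernoulli_pmf (w x)) (f x))"
    by (intro expectation_prod_Pi_pmf V) (auto simp: f_def intro!: integrable_measure_pmf_finite)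
  also have "\<dots> = (\<Prod>x\<in>F. 1 + w x * (exp l - 1))"
    using F w by (intro prod.mono_neutral_cong_right V) (auto simp: f_def algebra_simps subset_iff)
  also have "\<dots> \<le> (\<Prod>x\<in>F. exp (w x * (exp l - 1)))"
  proof (intro prod_mono conjI)
    fix x assume "x \<in> F"
    then have "0 \<le> w x * exp l" "w x \<le> 1" using w F by auto
    then show "0 \<le> 1 + w x * (exp l - 1)" by (simp add: algebra_simps)
  qed simp
  also have "\<dots> = exp ((exp l - 1) * (\<Sum>x\<in>F. w x))"
    by (simp add: exp_sum[OF finF, symmetric] sum_distrib_left mult.commute[of "exp l - 1"])
  finally show ?thesis .
qed

text \<open>Markov's inequality for the exponential. Keeping \<open>l\<close> inside the event lets
  negative \<open>l\<close> give the lower tail.\<close>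

lemma bernoulli_subset_chernoff:
  fixes l a :: real
  assumes "finite V" "F \<subseteq> V" "\<And>x. x \<in> V \<Longrightarrow> 0 \<le> w x \<and> w x \<le> 1"
  shows "measure_pmf.prob (bernoulli_subset V w) {G. l * real (card (G \<inter> F)) \<ge> a}
    \<le> exp ((exp l - 1) * (\<Sum>x\<in>F. w x) - a)"
proof -
  let ?u = "\<lambda>G. exp (l * real (card (G \<inter> F)))"
  have "measure_pmf.prob (bernoulli_subset V w) {G \<in> space (bernoulli_subset V w). ?u G \<ge> exp a}
      \<le> measure_pmf.expectation (bernoulli_subset V w) ?u / exp a"
    by (rule integral_Markov_inequality_measure[where A = "{}"])
      (auto intro!: integrable_measure_pmf_finite finite_set_bernoulli_subset assms)
  also have "\<dots> \<le> exp ((exp l - 1) * (\<Sum>x\<in>F. w x)) / exp a"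
    by (intro divide_right_mono bernoulli_subset_mgf_le assms) auto
  finally show ?thesis by (simp add: exp_diff)
qed

text \<open>\<open>M\<close> is kept apart from \<open>m\<close> so that it can be enlarged until
  \<open>t \<le> 2 * M\<close> holds; with \<open>M = m\<close> this would fail below for large
  \<open>c\<close>.\<close>

lemma bernoulli_subset_upper_tail:
  fixes m M t :: real
  assumes "finite V" "F \<subseteq> V" "\<And>x. x \<in> V \<Longrightarrow> 0 \<le> w x \<and> w x \<le> 1"
    and m: "(\<Sum>x\<in>F. w x) \<le> m" and M: "m \<le> M" "0 < M" and t: "0 \<le> t" "t \<le> 2 * M"
  shows "measure_pmf.prob (bernoulli_subset V w) {G. real (card (G \<inter> F)) \<ge> m + t}
    \<le> exp (- (t\<^sup>2 / (4 * M)))"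
proof -
  \<comment> \<open>The minimiser of \<open>l\<^sup>2 * M - l * t\<close>. Since
    \<open>t \<le> 2 * M\<close> it lies in [0, 1], where
    \<open>exp l \<le> 1 + l + l\<^sup>2\<close>.\<close>
  define l where "l = t / (2 * M)"
  have l: "0 \<le> l" "l \<le> 1" using M t by (auto simp: l_def)
  have "measure_pmf.prob (bernoulli_subset V w) {G. real (card (G \<inter> F)) \<ge> m + t}
      \<le> measure_pmf.prob (bernoulli_subset V w) {G. l * real (card (G \<inter> F)) \<ge> l * (m + t)}"
    by (rule measure_pmf.finite_measure_mono) (auto intro: mult_left_mono l)
  also have "\<dots> \<le> exp ((exp l - 1) * (\<Sum>x\<in>F. w x) - l * (m + t))"
    by (rule bernoulli_subset_chernoff) (use assms in auto)
  also have "\<dots> \<le> exp (- (t\<^sup>2 / (4 * M)))"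
  proof -
    have s: "0 \<le> (\<Sum>x\<in>F. w x)" using assms(2,3) by (intro sum_nonneg) auto
    have "(exp l - 1) * (\<Sum>x\<in>F. w x) \<le> (l + l\<^sup>2) * m"
      using exp_bound[OF l] m s l by (intro mult_mono) auto
    moreover have "l\<^sup>2 * m \<le> l\<^sup>2 * M" using M by (intro mult_left_mono) auto
    moreover have "l\<^sup>2 * M - l * t = - (t\<^sup>2 / (4 * M))"
      using M by (simp add: l_def field_simps power2_eq_square)
    ultimately show ?thesis by (simp add: algebra_simps)
  qed
  finally show ?thesis .
qed

text \<open>Multiplying by the quadratic Taylor lower bound of \<open>exp x\<close> gives
  \<open>1 + x ^ 4 / 4\<close>, which is at least 1.\<close>

lemma exp_minus_le_quadratic:
  fixes x :: real
  assumes "0 \<le> x"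
  shows "exp (- x) \<le> 1 - x + x\<^sup>2 / 2"
proof -
  have pos: "0 < 1 - x + x\<^sup>2 / 2"
  proof -
    have "1 - x + x\<^sup>2 / 2 = ((1 - x)\<^sup>2 + 1) / 2" by (simp add: power2_eq_square algebra_simps)
    also have "\<dots> > 0" by (simp add: add_nonneg_pos)
    finally show ?thesis .
  qed
  have "1 \<le> 1 + x ^ 4 / 4" by simp
  also have "\<dots> = (1 - x + x\<^sup>2 / 2) * (1 + x + x\<^sup>2 / 2)"
    by (simp add: power2_eq_square power4_eq_xxxx algebra_simps)
  also have "\<dots> \<le> (1 - x + x\<^sup>2 / 2) * exp x"
    using exp_lower_Taylor_quadratic[OF assms] pos by (intro mult_left_mono) auto
  finally show ?thesis by (simp add: exp_minus field_simps)
qed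

lemma bernoulli_subset_lower_tail:
  fixes m M t :: real
  assumes "finite V" "F \<subseteq> V" "\<And>x. x \<in> V \<Longrightarrow> 0 \<le> w x \<and> w x \<le> 1"
    and m: "0 \<le> m" "m \<le> (\<Sum>x\<in>F. w x)" and M: "m \<le> M" "0 < M" and t: "0 \<le> t"
  shows "measure_pmf.prob (bernoulli_subset V w) {G. real (card (G \<inter> F)) \<le> m - t}
    \<le> exp (- (t\<^sup>2 / (2 * M)))"
proof -
  \<comment> \<open>The minimiser of \<open>l\<^sup>2 / 2 * M - l * t\<close>. The quadratic bound
    on \<open>exp (- l)\<close> holds for all \<open>l \<ge> 0\<close>, so \<open>t\<close> needs no
    upper limit here.\<close>
  define l where "l = t / M"
  have l: "0 \<le> l" using M t by (simp add: l_def)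
  have "measure_pmf.prob (bernoulli_subset V w) {G. real (card (G \<inter> F)) \<le> m - t}
      \<le> measure_pmf.prob (bernoulli_subset V w) {G. (- l) * real (card (G \<inter> F)) \<ge> - l * (m - t)}"
    by (rule measure_pmf.finite_measure_mono) (auto intro: mult_left_mono l)
  also have "\<dots> \<le> exp ((exp (- l) - 1) * (\<Sum>x\<in>F. w x) - (- l * (m - t)))"
    by (rule bernoulli_subset_chernoff) (use assms in auto)
  also have "\<dots> \<le> exp (- (t\<^sup>2 / (2 * M)))"
  proof -
    \<comment> \<open>The factor \<open>exp (- l) - 1\<close> is nonpositive, hence a lower bound
      \<open>m\<close> on the mean suffices.\<close>
    have "(exp (- l) - 1) * (\<Sum>x\<in>F. w x) \<le> (exp (- l) - 1) * m"
      using m l by (intro mult_left_mono_neg) auto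
    also have "\<dots> \<le> (- l + l\<^sup>2 / 2) * m"
      using exp_minus_le_quadratic[OF l] m by (intro mult_right_mono) auto
    finally have "(exp (- l) - 1) * (\<Sum>x\<in>F. w x) \<le> - l * m + l\<^sup>2 / 2 * m"
      by (simp add: algebra_simps)
    moreover have "l\<^sup>2 / 2 * m \<le> l\<^sup>2 / 2 * M" using M by (intro mult_left_mono) auto
    moreover have "l\<^sup>2 / 2 * M - l * t = - (t\<^sup>2 / (2 * M))"
      using M by (simp add: l_def field_simps power2_eq_square)
    ultimately show ?thesis by (simp add: algebra_simps)
  qed
  finally show ?thesis .
qed

section \<open>Estimates for binomial coefficients\<close>

lemma real_choose_two: "real (n choose 2) = real n * (real n - 1) / 2"
proof (cases n)
  case (Suc m)
  have "even (n * (n - 1))" using Suc by auto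
  then show ?thesis unfolding choose_two using Suc by (simp add: real_of_nat_div algebra_simps)
qed simp

text \<open>The number \<open>K ^ K / fact K\<close> is a single term of the series of
  \<open>exp K\<close>; combine this with \<open>(N choose K) * fact K \<le> N ^ K\<close>.\<close>

lemma binomial_le_exp_ln:
  assumes "1 \<le> K" "K \<le> N"
  shows "real (N choose K) \<le> exp (real K * ln (real N * exp 1 / real K))"
proof -
  have "real K ^ K / fact K \<le> exp (real K)"
  proof -
    have "(\<lambda>n. real K ^ n /\<^sub>R fact n) sums exp (real K)" by (rule exp_converges)
    then have "(\<Sum>n\<in>{K}. real K ^ n /\<^sub>R fact n) \<le> exp (real K)"
      by (intro sum_le_suminf[of "\<lambda>n. real K ^ n /\<^sub>R fact n", THEN order_trans])
        (auto simp: sums_iff)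
    then show ?thesis by (simp add: field_simps)
  qed
  then have f: "real K ^ K \<le> exp (real K) * fact K" by (simp add: field_simps)
  have "real (N choose K) * fact K \<le> real N ^ K"
    using binomial_fact_pow[of N K] by (metis of_nat_fact of_nat_le_iff of_nat_mult of_nat_power)
  then have "real (N choose K) * fact K * real K ^ K \<le> real N ^ K * (exp (real K) * fact K)"
    using f by (intro mult_mono) auto
  then have "real (N choose K) \<le> real N ^ K * exp (real K) / real K ^ K"
    using assms by (simp add: field_simps)
  also have "\<dots> = (real N * exp 1 / real K) ^ K"
    by (simp add: power_divide power_mult_distrib exp_of_nat_mult[symmetric])
  also have "\<dots> = exp (real K * ln (real N * exp 1 / real K))"
    using assms by (simp add: exp_of_nat_mult)
  finally show ?thesis .
qed

section \<open>Mean edge counts and tails for one fixed vertex set\<close>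

lemma factor_le_one:
  fixes c q :: real
  assumes "1 < c" "0 < q" "c * q \<le> 1"
  shows "q \<le> 1"
proof -
  have "1 * q \<le> c * q" using assms by (intro mult_right_mono) auto
  then show ?thesis using assms by linarith
qed

text \<open>Every pair in \<open>V\<close> contributes \<open>q\<close>, and the pairs inside
  \<open>V \<inter> S\<close> contribute a further \<open>p - q\<close>. This is the mean edge count
  given the community.\<close>

lemma sum_planted_weights:
  fixes p q :: real
  assumes "finite V"
  shows "(\<Sum>e\<in>pairs V. if e \<subseteq> S then p else q)
    = real (card V choose 2) * q + real (card (V \<inter> S) choose 2) * (p - q)"
proof -
  have "(\<Sum>e\<in>pairs V. if e \<subseteq> S then p else q)
      = (\<Sum>e\<in>pairs V. q + (if e \<in> pairs (V \<inter> S) then p - q else 0))"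
    by (intro sum.cong) (auto simp: pairs_def)
  also have "\<dots> = real (card (pairs V)) * q + real (card (pairs V \<inter> pairs (V \<inter> S))) * (p - q)"
    using finite_pairs[OF assms] by (simp add: sum.distrib sum.inter_restrict[symmetric])
  also have "pairs V \<inter> pairs (V \<inter> S) = pairs (V \<inter> S)" by (auto simp: pairs_def)
  finally show ?thesis using assms by (simp add: card_pairs)
qed

lemma choose_two_ge_of_ge_nine_tenths:
  assumes "2 \<le> K" "9 / 10 * real K \<le> real s"
  shows "7 / 10 * real (K choose 2) \<le> real (s choose 2)"
proof -
  have "2 \<le> real K" using assms(1) by simp
  \<comment> \<open>This is exactly the difference of the two sides of the next inequality.\<close>
  then have "0 \<le> real K * (11 * real K - 20) / 100" by simp
  then have "7 / 10 * (real K * (real K - 1)) \<le> (9 / 10 * real K) * (9 / 10 * real K - 1)"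
    by (simp add: field_simps)
  also have "(9 / 10 * real K) * (9 / 10 * real K - 1) \<le> real s * (real s - 1)"
    using assms by (intro mult_mono) auto
  finally show ?thesis by (simp add: real_choose_two)
qed

text \<open>A common bound for the null and the alternative tails of the number of edges inside an
  \<open>n\<close>-set; \<open>100\<close> is a convenient majorant of the constants \<open>16\<close> and \<open>50\<close> that arise.\<close>

definition detection_error :: "real \<Rightarrow> nat \<Rightarrow> nat \<Rightarrow> real \<Rightarrow> real" where
  "detection_error c K n q =
     exp (- ((real (K choose 2))\<^sup>2 * (c - 1)\<^sup>2 * q / (100 * c * real (n choose 2))))"

lemma null_upper_tail:
  assumes "c > 1" "0 < q" "c * q \<le> 1" "2 \<le> K" "K \<le> card V" "V \<subseteq> {1..N}"
  shows "measure_pmf.prob (erdos_renyi N q)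
      {G. real (card (G \<inter> pairs V)) > real (card V choose 2) * q + real (K choose 2) * ((c * q - q) / 2)}
    \<le> detection_error c K (card V) q"
proof -
  define k where "k = real (K choose 2)"
  define f where "f = real (card V choose 2)"
  have finV: "finite V" using assms(6) finite_subset by blast
  have "0 < k" using assms(4) by (simp add: k_def zero_less_binomial)
  have "k \<le> f" using assms(5) by (simp add: k_def f_def binomial_right_mono)
  have q1: "q \<le> 1" using assms(1-3) by (rule factor_le_one)
  \<comment> \<open>Prepares the condition \<open>t \<le> 2 * M\<close> of the upper tail with
    \<open>M = c * f * q\<close>. The choice \<open>M = f * q\<close> would be too small for large
    \<open>c\<close>.\<close>
  have "k * (c - 1) * q \<le> f * c * q"
    using \<open>0 < k\<close> \<open>k \<le> f\<close> assms by (intro mult_mono) auto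
  moreover have "0 \<le> f * c * q" using \<open>0 < k\<close> \<open>k \<le> f\<close> assms by auto
  ultimately have t: "k * ((c * q - q) / 2) \<le> 2 * (c * (f * q))" by (simp add: algebra_simps)
  have "measure_pmf.prob (erdos_renyi N q) {G. real (card (G \<inter> pairs V)) > f * q + k * ((c * q - q) / 2)}
      \<le> measure_pmf.prob (erdos_renyi N q) {G. real (card (G \<inter> pairs V)) \<ge> f * q + k * ((c * q - q) / 2)}"
    by (rule measure_pmf.finite_measure_mono) auto
  also have "\<dots> \<le> exp (- ((k * ((c * q - q) / 2))\<^sup>2 / (4 * (c * (f * q)))))"
    unfolding erdos_renyi_def vertex_pairs_eq
    using assms \<open>0 < k\<close> \<open>k \<le> f\<close> q1 t finV
    by (intro bernoulli_subset_upper_tail finite_pairs pairs_mono) (auto simp: card_pairs f_def)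
  also have "\<dots> \<le> exp (- (k\<^sup>2 * (c - 1)\<^sup>2 * q / (100 * c * f)))"
  proof -
    have "(k * ((c * q - q) / 2))\<^sup>2 / (4 * (c * (f * q))) = k\<^sup>2 * (c - 1)\<^sup>2 * q / (16 * c * f)"
      using assms \<open>0 < k\<close> \<open>k \<le> f\<close> by (simp add: field_simps power2_eq_square)
    also have "\<dots> \<ge> k\<^sup>2 * (c - 1)\<^sup>2 * q / (100 * c * f)"
      using assms \<open>0 < k\<close> \<open>k \<le> f\<close> by (intro divide_left_mono) auto
    finally show ?thesis by simp
  qed
  finally show ?thesis by (simp add: detection_error_def k_def f_def)
qed

lemma planted_lower_tail_given_community:
  assumes "c > 1" "0 < q" "c * q \<le> 1" "2 \<le> K" "K \<le> card V" "V \<subseteq> {1..N}"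
    and S: "9 / 10 * real K \<le> real (card (V \<inter> S))"
  shows "measure_pmf.prob (bernoulli_subset (vertex_pairs N) (\<lambda>e. if e \<subseteq> S then c * q else q))
      {G. real (card (G \<inter> pairs V)) \<le> real (card V choose 2) * q + real (K choose 2) * ((c * q - q) / 2)}
    \<le> detection_error c K (card V) q"
proof -
  define k where "k = real (K choose 2)"
  define f where "f = real (card V choose 2)"
  have finV: "finite V" using assms(6) finite_subset by blast
  have "0 < k" using assms(4) by (simp add: k_def zero_less_binomial)
  have "k \<le> f" using assms(5) by (simp add: k_def f_def binomial_right_mono)
  have q1: "q \<le> 1" using assms(1-3) by (rule factor_le_one)
  \<comment> \<open>\<open>m\<close> is a lower bound on the planted mean. The threshold has 1/2 in
    place of 7/10, so the gap \<open>t\<close> has coefficient 7/10 - 1/2 = 1/5.\<close>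
  define m where "m = f * q + 7 / 10 * k * (c * q - q)"
  define t where "t = 1 / 5 * k * (c * q - q)"
  have cq: "0 < c * q - q" using assms by simp
  have "7 / 10 * k * (c * q - q) \<le> f * (c * q - q)"
    using \<open>0 < k\<close> \<open>k \<le> f\<close> cq by (intro mult_right_mono) auto
  then have mM: "m \<le> c * f * q" by (simp add: m_def algebra_simps)
  have "7 / 10 * k * (c * q - q) \<le> real (card (V \<inter> S) choose 2) * (c * q - q)"
    using choose_two_ge_of_ge_nine_tenths[OF assms(4) S] cq
    by (intro mult_right_mono) (auto simp: k_def)
  then have m: "m \<le> (\<Sum>e\<in>pairs V. if e \<subseteq> S then c * q else q)"
    by (simp add: sum_planted_weights[OF finV] m_def f_def)
  have eq: "f * q + k * ((c * q - q) / 2) = m - t" by (simp add: m_def t_def algebra_simps)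
  have "measure_pmf.prob (bernoulli_subset (vertex_pairs N) (\<lambda>e. if e \<subseteq> S then c * q else q))
      {G. real (card (G \<inter> pairs V)) \<le> m - t} \<le> exp (- (t\<^sup>2 / (2 * (c * f * q))))"
    unfolding vertex_pairs_eq
  proof (intro bernoulli_subset_lower_tail finite_pairs pairs_mono m mM)
    show "0 \<le> m" using \<open>0 < k\<close> \<open>k \<le> f\<close> cq assms unfolding m_def by (intro add_nonneg_nonneg) auto
    show "0 \<le> t" using \<open>0 < k\<close> cq unfolding t_def by simp
  qed (use assms \<open>0 < k\<close> \<open>k \<le> f\<close> q1 in auto)
  also have "\<dots> \<le> exp (- (k\<^sup>2 * (c - 1)\<^sup>2 * q / (100 * c * f)))"
  proof -
    have "t\<^sup>2 / (2 * (c * f * q)) = k\<^sup>2 * (c - 1)\<^sup>2 * q / (50 * c * f)"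
      using assms \<open>0 < k\<close> \<open>k \<le> f\<close> by (simp add: t_def field_simps power2_eq_square)
    also have "\<dots> \<ge> k\<^sup>2 * (c - 1)\<^sup>2 * q / (100 * c * f)"
      using assms \<open>0 < k\<close> \<open>k \<le> f\<close> by (intro divide_left_mono) auto
    finally show ?thesis by simp
  qed
  finally show ?thesis by (simp add: detection_error_def flip: eq k_def f_def)
qed

section \<open>Averaging over the planted community\<close>

lemma prob_bind_pmf_le:
  assumes "\<And>x. x \<in> set_pmf M \<Longrightarrow> x \<notin> B \<Longrightarrow> measure_pmf.prob (f x) A \<le> d" "0 \<le> d"
  shows "measure_pmf.prob (bind_pmf M f) A \<le> d + measure_pmf.prob M B"
proof -
  have "ennreal (measure_pmf.prob (bind_pmf M f) A) = (\<integral>\<^sup>+x. ennreal (measure_pmf.prob (f x) A) \<partial>M)"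
    by (simp add: measure_pmf.emeasure_eq_measure[symmetric])
  \<comment> \<open>Outside \<open>B\<close> the conditional probability is at most
    \<open>d\<close>; on \<open>B\<close> it is bounded trivially by 1.\<close>
  also have "\<dots> \<le> (\<integral>\<^sup>+x. ennreal d + indicator B x \<partial>M)"
  proof (rule nn_integral_mono_AE, rule AE_pmfI)
    fix x assume x: "x \<in> set_pmf M"
    show "ennreal (measure_pmf.prob (f x) A) \<le> ennreal d + indicator B x"
    proof (cases "x \<in> B")
      case True
      have "ennreal (measure_pmf.prob (f x) A) \<le> 1" by simp
      then show ?thesis using True by (simp add: add_increasing)
    next
      case False
      then show ?thesis using assms x by simp
    qed
  qed
  also have "\<dots> = ennreal d + emeasure M B" by (simp add: nn_integral_add)
  also have "\<dots> = ennreal (d + measure_pmf.prob M B)"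
    using assms(2) by (simp add: measure_pmf.emeasure_eq_measure)
  finally show ?thesis using assms(2)
    by (subst (asm) ennreal_le_iff) auto
qed

text \<open>One statement for both tests: \<open>n = N\<close> for the linear one and
  \<open>n = K\<close> for the scan. The event \<open>A\<close> forces a low count in every
  \<open>n\<close>-set, so the set \<open>V\<close> may be chosen depending on
  \<open>S\<close>.\<close>

lemma planted_lower_tail:
  assumes "c > 1" "0 < q" "c * q \<le> 1" "2 \<le> K" "K \<le> n" "n \<le> N"
    and A: "\<And>G V. G \<in> A \<Longrightarrow> V \<subseteq> {1..N} \<Longrightarrow> card V = n \<Longrightarrow>
      real (card (G \<inter> pairs V)) \<le> real (n choose 2) * q + real (K choose 2) * ((c * q - q) / 2)"
  shows "measure_pmf.prob (planted_dense_subgraph N K (c * q) q) A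
    \<le> detection_error c K n q + exp (- real K / 200)"
proof -
  let ?M = "bernoulli_subset {1..N} (\<lambda>_. real K / real N)"
  let ?B = "{S. real (card (S \<inter> {1..N})) \<le> real K - real K / 10}"
  have "measure_pmf.prob (planted_dense_subgraph N K (c * q) q) A
      \<le> detection_error c K n q + measure_pmf.prob ?M ?B"
    unfolding planted_dense_subgraph_def
  proof (rule prob_bind_pmf_le)
    fix S assume "S \<notin> ?B"
    then have S: "9 / 10 * real K \<le> real (card (S \<inter> {1..N}))" by simp
    define U where "U = S \<inter> {1..N}"
    have finU: "finite U" "U \<subseteq> {1..N}" by (auto simp: U_def)
    \<comment> \<open>\<open>V\<close> contains \<open>U\<close> or is contained in it, according to their sizes.\<close>
    obtain V where V: "V \<subseteq> {1..N}" "card V = n" "9 / 10 * real K \<le> real (card (V \<inter> S))"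
    proof (cases "card U \<le> n")
      case True
      then obtain V where V: "U \<subseteq> V" "V \<subseteq> {1..N}" "card V = n"
        using exists_subset_between[of U n "{1..N}"] finU assms(6) by auto
      then have "V \<inter> S = U" by (auto simp: U_def)
      then show ?thesis using that V S by (simp add: U_def)
    next
      case False
      then obtain V where V: "V \<subseteq> U" "card V = n"
        by (metis nat_le_linear obtain_subset_with_card_n)
      then have "V \<inter> S = V" by (auto simp: U_def)
      then show ?thesis using that[of V] V assms(5) finU by auto
    qed
    have "measure_pmf.prob (bernoulli_subset (vertex_pairs N) (\<lambda>e. if e \<subseteq> S then c * q else q)) A
        \<le> measure_pmf.prob (bernoulli_subset (vertex_pairs N) (\<lambda>e. if e \<subseteq> S then c * q else q))
          {G. real (card (G \<inter> pairs V)) \<le> real (card V choose 2) * q + real (K choose 2) * ((c * q - q) / 2)}"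
      by (rule measure_pmf.finite_measure_mono) (use A V in auto)
    also have "\<dots> \<le> detection_error c K (card V) q"
      by (rule planted_lower_tail_given_community) (use assms V in auto)
    finally show "measure_pmf.prob (bernoulli_subset (vertex_pairs N) (\<lambda>e. if e \<subseteq> S then c * q else q)) A
        \<le> detection_error c K n q" using V by simp
  qed (simp add: detection_error_def)
  \<comment> \<open>The mean of \<open>card S\<close> is \<open>N * (K / N) = K\<close>; the lower
    tail is taken with \<open>m = M = K\<close> and \<open>t = K / 10\<close>.\<close>
  also have "measure_pmf.prob ?M ?B \<le> exp (- ((real K / 10)\<^sup>2 / (2 * real K)))"
    using assms by (intro bernoulli_subset_lower_tail) auto
  also have "(real K / 10)\<^sup>2 / (2 * real K) = real K / 200"
    using assms by (simp add: field_simps power2_eq_square)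
  finally show ?thesis by simp
qed

section \<open>Union bound for the scan test, and comparison of exponents\<close>

lemma T_scan_null_tail:
  assumes "c > 1" "0 < q" "c * q \<le> 1" "2 \<le> K" "K \<le> N"
  shows "measure_pmf.prob (erdos_renyi N q) {G. T_scan N K (adj G) > tau2 K (c * q) q}
    \<le> real (N choose K) * detection_error c K K q"
proof -
  let ?P = "{V. V \<subseteq> {1..N} \<and> card V = K}"
  let ?A = "\<lambda>V. {G. real (card (G \<inter> pairs V)) > tau2 K (c * q) q}"
  have tau: "tau2 K (c * q) q = real (K choose 2) * q + real (K choose 2) * ((c * q - q) / 2)"
    by (simp add: tau2_def field_simps)
  have "measure_pmf.prob (erdos_renyi N q) {G. T_scan N K (adj G) > tau2 K (c * q) q}
      = measure_pmf.prob (erdos_renyi N q) (\<Union>V\<in>?P. ?A V)"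
    by (intro arg_cong[where f = "measure_pmf.prob _"]) (auto simp: T_scan_gt_iff[OF assms(5)])
  also have "\<dots> \<le> (\<Sum>V\<in>?P. measure_pmf.prob (erdos_renyi N q) (?A V))"
    by (intro measure_pmf.finite_measure_subadditive_finite finite_subsets_of_card) auto
  also have "\<dots> \<le> (\<Sum>V\<in>?P. detection_error c K K q)"
  proof (rule sum_mono)
    fix V assume "V \<in> ?P"
    then show "measure_pmf.prob (erdos_renyi N q) (?A V) \<le> detection_error c K K q"
      using null_upper_tail[of c q K V N] assms by (auto simp: tau)
  qed
  also have "\<dots> = real (N choose K) * detection_error c K K q"
    using n_subsets[of "{1..N}" K] by simp
  finally show ?thesis .
qed

text \<open>Amounts to \<open>K \<le> 2 * (K - 1)\<close>. It fails for \<open>K = 1\<close>, which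
  the theorem therefore treats separately.\<close>

lemma sqr_le_four_choose_two: "2 \<le> K \<Longrightarrow> real K ^ 2 \<le> 4 * real (K choose 2)"
  using mult_right_mono[of 2 "real K" "real K"]
  by (simp add: real_choose_two power2_eq_square algebra_simps)

lemma detection_error_lin_le:
  assumes "c > 1" "0 < q" "2 \<le> K" "K \<le> N" "C \<le> (c - 1)\<^sup>2 / (800 * c)"
  shows "detection_error c K N q \<le> exp (- C * (real K ^ 4 * q / real N ^ 2))"
proof -
  define k where "k = real (K choose 2)"
  define f where "f = real (N choose 2)"
  have f: "0 < f" using assms by (simp add: f_def zero_less_binomial)
  have fN: "2 * f \<le> real N ^ 2" by (simp add: f_def real_choose_two power2_eq_square algebra_simps)
  have "real K ^ 4 = (real K ^ 2)\<^sup>2" by simp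
  also have "\<dots> \<le> (4 * k)\<^sup>2"
    using sqr_le_four_choose_two[OF assms(3)] by (intro power_mono) (auto simp: k_def)
  finally have kK: "real K ^ 4 \<le> 16 * k\<^sup>2" by (simp add: power_mult_distrib)
  \<comment> \<open>The constant 800 comes from here: the factor 16/2 = 8 turns 1/800 into the 1/100
    of \<open>detection_error\<close>.\<close>
  have "C * (real K ^ 4 * q / real N ^ 2) \<le> (c - 1)\<^sup>2 / (800 * c) * (16 * k\<^sup>2 * q / (2 * f))"
    using assms kK fN f by (intro mult_mono frac_le) auto
  also have "\<dots> = k\<^sup>2 * (c - 1)\<^sup>2 * q / (100 * c * f)"
    using assms f by (simp add: field_simps)
  finally show ?thesis by (simp add: detection_error_def k_def f_def)
qed

lemma detection_error_scan_le:
  assumes "c > 1" "0 < q" "2 \<le> K" "C \<le> (c - 1)\<^sup>2 / (800 * c)"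
  shows "detection_error c K K q \<le> exp (- (C * real K ^ 2 * q))"
proof -
  define k where "k = real (K choose 2)"
  have k: "0 < k" using assms by (simp add: k_def zero_less_binomial)
  \<comment> \<open>Here the factor is only 4, which leaves 1/200 and thus a factor of two to
    spare.\<close>
  have "C * (real K ^ 2 * q) \<le> (c - 1)\<^sup>2 / (800 * c) * (4 * k * q)"
    using assms sqr_le_four_choose_two[OF assms(3)] k
    by (intro mult_mono) (auto simp: k_def)
  also have "\<dots> = k\<^sup>2 * (c - 1)\<^sup>2 * q / (200 * c * k)"
    using assms k by (simp add: power2_eq_square divide_simps)
  also have "\<dots> \<le> k\<^sup>2 * (c - 1)\<^sup>2 * q / (100 * c * k)"
    using assms k by (intro divide_left_mono) auto
  finally show ?thesis by (simp add: detection_error_def k_def mult.assoc)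
qed

section \<open>Assembling the two tests\<close>

theorem proposition2:
  fixes c :: real
  assumes "c > 1"
  shows "\<exists>C>0. \<forall>(N::nat) (K::nat) (p::real) (q::real).
    1 \<le> K \<and> K \<le> N \<and> 0 < q \<and> p = c * q \<and> p \<le> 1 \<longrightarrow>
      measure_pmf.prob (erdos_renyi N q) {G. T_lin N (adj G) > tau1 N K p q}
        + measure_pmf.prob (planted_dense_subgraph N K p q) {G. T_lin N (adj G) \<le> tau1 N K p q}
        \<le> 2 * exp (- C * (real K ^ 4 * q / real N ^ 2)) + exp (- real K / 200)
    \<and> measure_pmf.prob (erdos_renyi N q) {G. T_scan N K (adj G) > tau2 K p q}
        + measure_pmf.prob (planted_dense_subgraph N K p q) {G. T_scan N K (adj G) \<le> tau2 K p q}
        \<le> 2 * exp (real K * ln (real N * exp 1 / real K) - C * real K ^ 2 * q) + exp (- real K / 200)"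
proof -
  \<comment> \<open>The bound 1/4 serves the case \<open>K = 1\<close>, the other one the case
    \<open>K \<ge> 2\<close>.\<close>
  define C where "C = min (1 / 4) ((c - 1)\<^sup>2 / (800 * c))"
  have C: "0 < C" "C \<le> 1 / 4" "C \<le> (c - 1)\<^sup>2 / (800 * c)"
    using assms by (auto simp: C_def)
  show ?thesis
  proof (intro exI[of _ C] conjI[OF C(1)] allI impI, elim conjE)
    fix N K :: nat and p q :: real
    assume K: "1 \<le> K" "K \<le> N" and q: "0 < q" and p: "p = c * q" and "p \<le> 1"
    then have p1: "c * q \<le> 1" by simp
    have q1: "q \<le> 1" using assms q p1 by (rule factor_le_one)
    show "measure_pmf.prob (erdos_renyi N q) {G. T_lin N (adj G) > tau1 N K p q}
        + measure_pmf.prob (planted_dense_subgraph N K p q) {G. T_lin N (adj G) \<le> tau1 N K p q}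
        \<le> 2 * exp (- C * (real K ^ 4 * q / real N ^ 2)) + exp (- real K / 200)
      \<and> measure_pmf.prob (erdos_renyi N q) {G. T_scan N K (adj G) > tau2 K p q}
        + measure_pmf.prob (planted_dense_subgraph N K p q) {G. T_scan N K (adj G) \<le> tau2 K p q}
        \<le> 2 * exp (real K * ln (real N * exp 1 / real K) - C * real K ^ 2 * q) + exp (- real K / 200)"
      (is "?lin0 + ?lin1 \<le> ?boundlin \<and> ?scan0 + ?scan1 \<le> ?boundscan")
    proof (cases "K = 1")
      case True
      have triv: "?lin0 + ?lin1 \<le> 2" "?scan0 + ?scan1 \<le> 2"
        by (smt (verit) measure_pmf.prob_le_1)+
      \<comment> \<open>Two probabilities sum to at most 2, so it is enough that each right-hand
        side reaches 2. For the linear test, 2 * 3/4 + 199/200 exceeds 2.\<close>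
      have "q / real N ^ 2 \<le> 1 / 1"
        using q q1 K by (intro frac_le) auto
      then have "C * (q / real N ^ 2) \<le> 1 / 4 * 1"
        using C q by (intro mult_mono) auto
      then have "3 / 4 \<le> exp (- C * (q / real N ^ 2))"
        using exp_ge_add_one_self[of "- C * (q / real N ^ 2)"] by simp
      moreover have "199 / 200 \<le> exp (- real K / 200)"
        using exp_ge_add_one_self[of "- real K / 200"] True by simp
      ultimately have "2 \<le> ?boundlin" using True by simp
      \<comment> \<open>For the scan test the exponent is at least 1 - 1/4, so the doubled
        exponential alone is at least 2.\<close>
      have "1 \<le> ln (real N * exp 1)" using K by (simp add: ln_mult)
      moreover have "C * q \<le> 1 / 4 * 1" using C q q1 by (intro mult_mono) auto
      ultimately have "1 \<le> exp (ln (real N * exp 1) - C * q)" by simp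
      then have "2 \<le> ?boundscan" using True by (simp add: add_increasing2)
      with \<open>2 \<le> ?boundlin\<close> triv show ?thesis by linarith
    next
      case False
      then have K2: "2 \<le> K" using K by simp
      have t1: "tau1 N K p q = real (N choose 2) * q + real (K choose 2) * ((c * q - q) / 2)"
        by (simp add: tau1_def p)
      have t2: "tau2 K p q = real (K choose 2) * q + real (K choose 2) * ((c * q - q) / 2)"
        by (simp add: tau2_def p field_simps)
      have "?lin0 \<le> detection_error c K N q"
        using null_upper_tail[OF assms q p1 K2, of "{1..N}" N] K by (simp add: t1 T_lin_eq_card)
      moreover have "?lin1 \<le> detection_error c K N q + exp (- real K / 200)"
        unfolding p
      proof (rule planted_lower_tail[OF assms q p1 K2 K(2) order_refl])
        fix G V assume "G \<in> {G. T_lin N (adj G) \<le> tau1 N K (c * q) q}" "V \<subseteq> {1..N}" "card V = N"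
        \<comment> \<open>The only \<open>N\<close>-subset of \<open>{1..N}\<close> is
          \<open>{1..N}\<close> itself.\<close>
        then show "real (card (G \<inter> pairs V)) \<le> real (N choose 2) * q + real (K choose 2) * ((c * q - q) / 2)"
          using card_subset_eq[of "{1..N}" V] t1 p by (simp add: T_lin_eq_card)
      qed
      ultimately have lin: "?lin0 + ?lin1 \<le> ?boundlin"
        using detection_error_lin_le[OF assms q K2 K(2) C(3)] by linarith
      let ?L = "real K * ln (real N * exp 1 / real K)"
      \<comment> \<open>Nonnegativity of \<open>?L\<close> lets the planted error, which carries no
        union-bound factor, be absorbed into the same exponential as the null error; hence the
        factor 2.\<close>
      have "1 \<le> real N * exp 1 / real K"
        using K mult_mono[of "real K" "real N" 1 "exp 1"] by (simp add: field_simps)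
      then have "0 \<le> ?L" by simp
      have err: "detection_error c K K q \<le> exp (- (C * real K ^ 2 * q))"
        by (rule detection_error_scan_le[OF assms q K2 C(3)])
      have "?scan0 \<le> real (N choose K) * detection_error c K K q"
        using T_scan_null_tail[OF assms q p1 K2 K(2)] p by simp
      also have "\<dots> \<le> exp ?L * exp (- (C * real K ^ 2 * q))"
        using binomial_le_exp_ln[OF K] err by (intro mult_mono) (auto simp: detection_error_def)
      finally have "?scan0 \<le> exp (?L - C * real K ^ 2 * q)" by (simp add: exp_diff exp_minus field_simps)
      moreover have "?scan1 \<le> detection_error c K K q + exp (- real K / 200)"
        unfolding p
      proof (rule planted_lower_tail[OF assms q p1 K2 order_refl K(2)])
        fix G V assume "G \<in> {G. T_scan N K (adj G) \<le> tau2 K (c * q) q}" "V \<subseteq> {1..N}" "card V = K"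
        then show "real (card (G \<inter> pairs V)) \<le> real (K choose 2) * q + real (K choose 2) * ((c * q - q) / 2)"
          using T_scan_gt_iff[OF K(2), of "tau2 K p q" G] t2 p by (force simp: not_less)
      qed
      moreover have "exp (- (C * real K ^ 2 * q)) \<le> exp (?L - C * real K ^ 2 * q)"
        using \<open>0 \<le> ?L\<close> by simp
      ultimately have "?scan0 + ?scan1 \<le> ?boundscan" using err by linarith
      with lin show ?thesis by blast
    qed
  qed
qed

end
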